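(* Let $T>0$, $\ell\ge 0$, $\tau\in\mathbb{R}$, $\delta x>0$, $\rho_e>0$, and $N\ge 2$. Let $V(\rho)=\frac1T\big(\frac1\rho-\ell\big)$ and $G(x,y)=\frac1T(1-y\ell)$, and consider the Godunov/Euler scheme on $N$ cells with periodic boundary conditions (indices modulo $N$) and time step $\delta t>0$, $$\rho_i(t+\delta t)=\rho_i(t)+\frac{\delta t}{\delta x}\big(f_{i-1}(t)-f_i(t)\big),\qquad f_i=G(\rho_i,\rho_{i+1})+\frac{\tau}{\delta x}\big(\rho_iV'(\rho_i)\big)^2(\rho_{i+1}-\rho_i).$$ If $$2\tau<T\,\ell\,\delta x\,\rho_e^2,$$ and if $\delta t$ is sufficiently small (i.e. for all $\delta t\in(0,\delta t_0)$ for some $\delta t_0>0$), then the homogeneous configuration $\rho_i(t)=\rho_e$ for all $i$ and $t$ is linearly stable for this scheme.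
   Context: $T$ is the vehicles' time gap, $\ell$ the vehicle size, $\tau$ the reaction (or, if negative, anticipation) time, $V$ the optimal speed as a function of the density, and $G$ is the Godunov flux associated with the flow $\rho V(\rho)$ for this $V$. Linear stability: writing the scheme as $\rho_i(t+\delta t)=F(\rho_i(t),\rho_{i+1}(t),\rho_{i+2}(t),\rho_{i-1}(t))$, let $\alpha,\beta,\gamma,\xi$ be the partial derivatives of $F$ with respect to $\rho_i,\rho_{i+1},\rho_{i+2},\rho_{i-1}$ respectively, evaluated at $(\rho_e,\rho_e,\rho_e,\rho_e)$. The linearised system for the perturbations $\varepsilon_i=\rho_i-\rho_e$ is $$\varepsilon_i(t+\delta t)=\alpha\,\varepsilon_i(t)+\beta\,\varepsilon_{i+1}(t)+\gamma\,\varepsilon_{i+2}(t)+\xi\,\varepsilon_{i-1}(t),\qquad i\in\mathbb{Z}/N\mathbb{Z}.$$ The scheme conserves the total mass $\sum_i\rho_i$. The homogeneous configuration is called linearly stable if every solution of the linearised system whose initial perturbation satisfies $\sum_i\varepsilon_i(0)=0$ tends to $0$ as the number of time steps tends to infinity. *)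

theory Defs
  imports "HOL-Analysis.Analysis"
begin

definition opt_speed :: "real \<Rightarrow> real \<Rightarrow> real \<Rightarrow> real" where
  "opt_speed T l \<rho> = 1 / T * (1 / \<rho> - l)"

text \<open>
  The flow \<open>\<rho> * opt_speed T l \<rho> = (1 - \<rho> * l) / T\<close> is nonincreasing for \<open>l \<ge> 0\<close>, so its
  Godunov flux is the flow at the downstream density and does not depend on the first argument.
\<close>

definition godunov_flux :: "real \<Rightarrow> real \<Rightarrow> real \<Rightarrow> real \<Rightarrow> real" where
  "godunov_flux T l x y = 1 / T * (1 - y * l)"

definition cell_flux :: "real \<Rightarrow> real \<Rightarrow> real \<Rightarrow> real \<Rightarrow> real \<Rightarrow> real \<Rightarrow> real" where
  "cell_flux T l \<tau> dx x y =
     godunov_flux T l x y + \<tau> / dx * (x * deriv (opt_speed T l) x)\<^sup>2 * (y - x)"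

text \<open>
  The arguments \<open>a b c d\<close> of the update rule are the densities of the cells
  \<open>i\<close>, \<open>i + 1\<close>, \<open>i + 2\<close>, \<open>i - 1\<close>, in this order; this scheme does not use \<open>c\<close>.
\<close>

definition scheme_update ::
    "real \<Rightarrow> real \<Rightarrow> real \<Rightarrow> real \<Rightarrow> real \<Rightarrow> real \<Rightarrow> real \<Rightarrow> real \<Rightarrow> real \<Rightarrow> real" where
  "scheme_update T l \<tau> dx dt a b c d =
     a + dt / dx * (cell_flux T l \<tau> dx d a - cell_flux T l \<tau> dx a b)"

lemma scheme_update_cells:
  fixes \<rho> f :: "nat \<Rightarrow> real"
  assumes "i < N"
    and f: "\<And>j. f j = cell_flux T l \<tau> dx (\<rho> j) (\<rho> ((j + 1) mod N))"
  shows "scheme_update T l \<tau> dx dt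
           (\<rho> i) (\<rho> ((i + 1) mod N)) (\<rho> ((i + 2) mod N)) (\<rho> ((i + N - 1) mod N)) =
         \<rho> i + dt / dx * (f ((i + N - 1) mod N) - f i)"
proof -
  have "((i + N - 1) mod N + 1) mod N = (i + N - 1 + 1) mod N"
    by (rule mod_add_left_eq)
  also have "\<dots> = i"
    using assms(1) by simp
  finally show ?thesis
    by (simp add: scheme_update_def f)
qed

text \<open>
  \<open>\<epsilon> n i\<close> is the perturbation of cell \<open>i\<close> after \<open>n\<close> time steps. Cells are \<open>0, \<dots>, N - 1\<close> with
  indices modulo \<open>N\<close>; \<open>i + N - 1\<close> stands for \<open>i - 1\<close>, avoiding truncated subtraction.
\<close>

definition linearised_solution ::
    "nat \<Rightarrow> real \<Rightarrow> real \<Rightarrow> real \<Rightarrow> real \<Rightarrow> (nat \<Rightarrow> nat \<Rightarrow> real) \<Rightarrow> bool" where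
  "linearised_solution N \<alpha> \<beta> \<gamma> \<xi> \<epsilon> \<longleftrightarrow>
     (\<forall>n. \<forall>i<N. \<epsilon> (Suc n) i =
        \<alpha> * \<epsilon> n i + \<beta> * \<epsilon> n ((i + 1) mod N) + \<gamma> * \<epsilon> n ((i + 2) mod N)
        + \<xi> * \<epsilon> n ((i + N - 1) mod N))"

text \<open>
  The partial derivatives are taken with respect to the four formal arguments of \<open>F\<close>, which are
  treated as independent also when \<open>N \<le> 3\<close> and some of the neighbouring cells coincide. Their
  existence is part of the definition, and their values are unique.
\<close>

definition linearly_stable ::
    "nat \<Rightarrow> (real \<Rightarrow> real \<Rightarrow> real \<Rightarrow> real \<Rightarrow> real) \<Rightarrow> real \<Rightarrow> bool" where
  "linearly_stable N F \<rho>e \<longleftrightarrow>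
     (\<exists>\<alpha> \<beta> \<gamma> \<xi>.
        ((\<lambda>x. F x \<rho>e \<rho>e \<rho>e) has_real_derivative \<alpha>) (at \<rho>e) \<and>
        ((\<lambda>x. F \<rho>e x \<rho>e \<rho>e) has_real_derivative \<beta>) (at \<rho>e) \<and>
        ((\<lambda>x. F \<rho>e \<rho>e x \<rho>e) has_real_derivative \<gamma>) (at \<rho>e) \<and>
        ((\<lambda>x. F \<rho>e \<rho>e \<rho>e x) has_real_derivative \<xi>) (at \<rho>e) \<and>
        (\<forall>\<epsilon>. linearised_solution N \<alpha> \<beta> \<gamma> \<xi> \<epsilon> \<and> (\<Sum>i<N. \<epsilon> 0 i) = 0 \<longrightarrow>
              (\<forall>i<N. (\<lambda>n. \<epsilon> n i) \<longlonglongrightarrow> 0)))"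

end

theory Submission imports Defs begin

text \<open>
  Put \<open>k = \<tau> / (dx T\<^sup>2 \<rho>e\<^sup>2)\<close> and \<open>s = dt / dx\<close>. Since \<open>\<rho> V'(\<rho>) = - 1 / (T \<rho>)\<close>, the
  linearised scheme has the weights \<open>\<beta> = s (l / T - k)\<close> on the cell ahead, \<open>\<xi> = - s k\<close> on the
  cell behind, \<open>\<gamma> = 0\<close>, and \<open>\<alpha> = 1 - \<beta> - \<xi>\<close> on the cell itself. The hypothesis
  \<open>2 \<tau> < T l dx \<rho>e\<^sup>2\<close> says exactly that \<open>\<beta> + \<xi> = s (l / T - 2 k)\<close> is positive. It allows
  \<open>\<xi> < 0\<close>, so the new value need not be a convex combination of old values and a maximum
  principle is not available. The proof uses the energy \<open>E = \<Sum>i. \<epsilon>\<^sub>i\<^sup>2\<close> instead.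

  The weights add up to \<open>1\<close>, so the square of the weighted mean is the weighted mean of the
  squares minus the sum of the squared differences, each pair weighted by the product of its
  weights. Summed over the ring, this gives for the energy \<open>E'\<close> after one step
  \<open>E' = E - \<alpha> (\<beta> + \<xi>) D - \<beta> \<xi> D2\<close>, where \<open>D\<close> and \<open>D2\<close> are the sums of
  squared differences between cells at distance one and two, and \<open>0 \<le> D2 \<le> 4 D\<close>. According to
  the sign of \<open>\<beta> \<xi>\<close> the energy thus decreases by at least \<open>\<alpha> (\<beta> + \<xi>) D\<close> or
  \<open>(\<alpha> (\<beta> + \<xi>) + 4 \<beta> \<xi>) D\<close>; the two coefficients are \<open>\<beta> + \<xi> - (\<beta> + \<xi>)\<^sup>2\<close> and
  \<open>\<beta> + \<xi> - (\<beta> - \<xi>)\<^sup>2\<close>, linear minus quadratic in \<open>dt\<close>, hence positive for small \<open>dt\<close>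
  (\<open>three_point_energy_decay\<close>).

  A nonnegative energy that decreases by a fixed positive multiple of \<open>D\<close> in every step forces
  \<open>D\<close> to tend to \<open>0\<close>. Neighbouring cells, and so all cells, then become equal in the limit; as
  the total mass stays \<open>0\<close>, the common limit is \<open>0\<close>
  (\<open>three_point_solution_tendsto_zero\<close>).
\<close>

section \<open>Cyclic sums\<close>

lemma sum_cyclic_shift:
  fixes f :: "nat \<Rightarrow> 'a :: comm_monoid_add"
  shows "(\<Sum>i<N. f ((i + k) mod N)) = (\<Sum>i<N. f i)"
proof (induction k)
  case 0
  show ?case by (rule sum.cong) auto
next
  case (Suc k)
  show ?case
  proof (cases N)
    case 0
    then show ?thesis by simp
  next
    case (Suc M)
    have "(\<Sum>i<N. f ((i + Suc k) mod N)) = (\<Sum>i<M. f ((Suc i + k) mod N)) + f (k mod N)"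
      using Suc mod_add_self1[of N k] by simp
    also have "\<dots> = (\<Sum>i<N. f ((i + k) mod N))"
      using Suc by (simp only: sum.lessThan_Suc_shift) (simp add: add.commute)
    finally show ?thesis using Suc.IH by simp
  qed
qed

lemma cyclic_pred_succ:
  fixes i N :: nat
  assumes "i < N"
  shows "((i + N - 1) mod N + 1) mod N = i"
proof -
  have "((i + N - 1) mod N + 1) mod N = (i + N - 1 + 1) mod N"
    by (rule mod_add_left_eq)
  then show ?thesis using assms by simp
qed

lemma sum_cyclic_pred:
  fixes f :: "nat \<Rightarrow> 'a :: comm_monoid_add"
  shows "(\<Sum>i<N. f ((i + N - 1) mod N)) = (\<Sum>i<N. f i)"
proof (cases "N = 0")
  case False
  then have "(\<Sum>i<N. f ((i + N - 1) mod N)) = (\<Sum>i<N. f ((i + (N - 1)) mod N))"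
    by (intro sum.cong) auto
  then show ?thesis by (simp only: sum_cyclic_shift)
qed simp

section \<open>Energy decay of three-point schemes\<close>

definition cyclic_variation :: "nat \<Rightarrow> (nat \<Rightarrow> real) \<Rightarrow> real" where
  "cyclic_variation N u = (\<Sum>i<N. (u ((i + 1) mod N) - u i)\<^sup>2)"

lemma cyclic_variation_pred:
  "(\<Sum>i<N. (u i - u ((i + N - 1) mod N))\<^sup>2) = cyclic_variation N u"
proof -
  have "(\<Sum>i<N. (u i - u ((i + N - 1) mod N))\<^sup>2) =
      (\<Sum>i<N. (\<lambda>j. (u ((j + 1) mod N) - u j)\<^sup>2) ((i + N - 1) mod N))"
    by (intro sum.cong refl) (simp only: lessThan_iff cyclic_pred_succ)
  also have "\<dots> = cyclic_variation N u"
    unfolding cyclic_variation_def by (rule sum_cyclic_pred)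
  finally show ?thesis .
qed

text \<open>
  For \<open>\<beta> \<xi> < 0\<close> the term with the distance-two differences works against the decay; the
  parallelogram inequality bounds it by four times the variation. Each sign of \<open>\<beta> \<xi>\<close>
  accounts for one entry of the minimum \<open>\<kappa>\<close>.
\<close>

lemma three_point_energy_decay:
  fixes \<beta> \<xi> :: real and u v :: "nat \<Rightarrow> real"
  defines "\<kappa> \<equiv> min (\<beta> + \<xi> - (\<beta> + \<xi>)\<^sup>2) (\<beta> + \<xi> - (\<beta> - \<xi>)\<^sup>2)"
  assumes v: "\<And>i. i < N \<Longrightarrow>
    v i = (1 - \<beta> - \<xi>) * u i + \<beta> * u ((i + 1) mod N) + \<xi> * u ((i + N - 1) mod N)"
  shows "(\<Sum>i<N. (v i)\<^sup>2) \<le> (\<Sum>i<N. (u i)\<^sup>2) - \<kappa> * cyclic_variation N u"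
proof -
  define \<alpha> where "\<alpha> = 1 - \<beta> - \<xi>"
  define y where "y i = u ((i + 1) mod N)" for i
  define z where "z i = u ((i + N - 1) mod N)" for i
  define D where "D = cyclic_variation N u"
  define D2 where "D2 = (\<Sum>i<N. (y i - z i)\<^sup>2)"
  have Dy: "(\<Sum>i<N. (y i - u i)\<^sup>2) = D"
    by (simp add: D_def cyclic_variation_def y_def)
  have Dz: "(\<Sum>i<N. (u i - z i)\<^sup>2) = D"
    unfolding D_def z_def by (rule cyclic_variation_pred)
  have Ey: "(\<Sum>i<N. (y i)\<^sup>2) = (\<Sum>i<N. (u i)\<^sup>2)"
    unfolding y_def by (rule sum_cyclic_shift)
  have Ez: "(\<Sum>i<N. (z i)\<^sup>2) = (\<Sum>i<N. (u i)\<^sup>2)"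
    unfolding z_def by (rule sum_cyclic_pred)
  have "(\<Sum>i<N. (v i)\<^sup>2) =
      (\<Sum>i<N. \<alpha> * (u i)\<^sup>2 + \<beta> * (y i)\<^sup>2 + \<xi> * (z i)\<^sup>2
        - \<alpha> * \<beta> * (y i - u i)\<^sup>2 - \<alpha> * \<xi> * (u i - z i)\<^sup>2 - \<beta> * \<xi> * (y i - z i)\<^sup>2)"
  proof (intro sum.cong refl)
    fix i assume "i \<in> {..<N}"
    then have vi: "v i = \<alpha> * u i + \<beta> * y i + \<xi> * z i"
      by (simp add: v \<alpha>_def y_def z_def)
    show "(v i)\<^sup>2 = \<alpha> * (u i)\<^sup>2 + \<beta> * (y i)\<^sup>2 + \<xi> * (z i)\<^sup>2
        - \<alpha> * \<beta> * (y i - u i)\<^sup>2 - \<alpha> * \<xi> * (u i - z i)\<^sup>2 - \<beta> * \<xi> * (y i - z i)\<^sup>2"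
      unfolding vi \<alpha>_def by (simp add: power2_eq_square algebra_simps)
  qed
  also have "\<dots> = (\<alpha> + \<beta> + \<xi>) * (\<Sum>i<N. (u i)\<^sup>2) - \<alpha> * (\<beta> + \<xi>) * D - \<beta> * \<xi> * D2"
    unfolding sum_subtractf sum.distrib sum_distrib_left[symmetric] Dy Dz Ey Ez
      D2_def[symmetric]
    by (simp add: algebra_simps)
  finally have step: "(\<Sum>i<N. (v i)\<^sup>2) =
      (\<Sum>i<N. (u i)\<^sup>2) - (\<alpha> * (\<beta> + \<xi>) * D + \<beta> * \<xi> * D2)"
    by (simp add: \<alpha>_def)
  have D_nonneg: "0 \<le> D" and D2_nonneg: "0 \<le> D2"
    by (simp_all add: D_def D2_def cyclic_variation_def sum_nonneg)
  have "D2 \<le> (\<Sum>i<N. 2 * (y i - u i)\<^sup>2 + 2 * (u i - z i)\<^sup>2)"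
    unfolding D2_def
  proof (rule sum_mono)
    fix i
    have "2 * (y i - u i)\<^sup>2 + 2 * (u i - z i)\<^sup>2 - (y i - z i)\<^sup>2 = (y i - 2 * u i + z i)\<^sup>2"
      by (simp add: power2_eq_square algebra_simps)
    then show "(y i - z i)\<^sup>2 \<le> 2 * (y i - u i)\<^sup>2 + 2 * (u i - z i)\<^sup>2"
      by (smt (verit) zero_le_power2)
  qed
  also have "\<dots> = 4 * D"
    unfolding sum.distrib sum_distrib_left[symmetric] Dy Dz by simp
  finally have D2_le: "D2 \<le> 4 * D" .
  have "\<kappa> * D \<le> \<alpha> * (\<beta> + \<xi>) * D + \<beta> * \<xi> * D2"
  proof (cases "0 \<le> \<beta> * \<xi>")
    case True
    have "\<kappa> * D \<le> (\<beta> + \<xi> - (\<beta> + \<xi>)\<^sup>2) * D"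
      using D_nonneg by (intro mult_right_mono) (simp_all add: \<kappa>_def)
    also have "\<dots> = \<alpha> * (\<beta> + \<xi>) * D"
      unfolding \<alpha>_def by (simp add: power2_eq_square algebra_simps)
    also have "\<dots> \<le> \<alpha> * (\<beta> + \<xi>) * D + \<beta> * \<xi> * D2"
      using True D2_nonneg by simp
    finally show ?thesis .
  next
    case False
    have "\<kappa> * D \<le> (\<beta> + \<xi> - (\<beta> - \<xi>)\<^sup>2) * D"
      using D_nonneg by (intro mult_right_mono) (simp_all add: \<kappa>_def)
    also have "\<dots> = \<alpha> * (\<beta> + \<xi>) * D + \<beta> * \<xi> * (4 * D)"
      unfolding \<alpha>_def by (simp add: power2_eq_square algebra_simps)
    also have "\<dots> \<le> \<alpha> * (\<beta> + \<xi>) * D + \<beta> * \<xi> * D2"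
      using False D2_le by (intro add_left_mono mult_left_mono_neg) simp_all
    finally show ?thesis .
  qed
  with step show ?thesis by (simp add: D_def)
qed

section \<open>Convergence to zero\<close>

lemma dissipation_tendsto_zero:
  fixes E D :: "nat \<Rightarrow> real"
  assumes "0 < \<kappa>" and E: "\<And>n. 0 \<le> E n" and D: "\<And>n. 0 \<le> D n"
    and step: "\<And>n. E (Suc n) \<le> E n - \<kappa> * D n"
  shows "D \<longlonglongrightarrow> 0"
proof -
  have "E (Suc n) \<le> E n" for n
    using step[of n] mult_nonneg_nonneg[of \<kappa> "D n"] D[of n] \<open>0 < \<kappa>\<close> by linarith
  then have "decseq E" by (simp add: decseq_Suc_iff)
  then obtain L where L: "E \<longlonglongrightarrow> L"
    using decseq_convergent[of E 0] E by blast
  then have "(\<lambda>n. (E n - E (Suc n)) / \<kappa>) \<longlonglongrightarrow> (L - L) / \<kappa>"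
    using \<open>0 < \<kappa>\<close>
    by (intro tendsto_divide tendsto_diff L LIMSEQ_Suc[OF L] tendsto_const) simp
  then have upper: "(\<lambda>n. (E n - E (Suc n)) / \<kappa>) \<longlonglongrightarrow> 0" by simp
  have D_le: "D n \<le> (E n - E (Suc n)) / \<kappa>" for n
    using step[of n] \<open>0 < \<kappa>\<close> by (simp add: field_simps)
  show ?thesis
    by (rule tendsto_sandwich[OF _ _ tendsto_const upper]) (simp_all add: D D_le)
qed

text \<open>
  Vanishing variation leaves only the constants, and the mass condition selects the constant
  \<open>0\<close>. This plays the part of a Poincare inequality on the ring.
\<close>

lemma tendsto_zero_if_cyclic_variation:
  fixes \<epsilon> :: "nat \<Rightarrow> nat \<Rightarrow> real"
  assumes D: "(\<lambda>n. cyclic_variation N (\<epsilon> n)) \<longlonglongrightarrow> 0"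
    and mass: "\<And>n. (\<Sum>i<N. \<epsilon> n i) = 0" and "i < N"
  shows "(\<lambda>n. \<epsilon> n i) \<longlonglongrightarrow> 0"
proof -
  have neighbours: "(\<lambda>n. \<epsilon> n (Suc j) - \<epsilon> n j) \<longlonglongrightarrow> 0" if "Suc j < N" for j
  proof -
    have "(\<epsilon> n (Suc j) - \<epsilon> n j)\<^sup>2 \<le> cyclic_variation N (\<epsilon> n)" for n
      using member_le_sum[of j "{..<N}" "\<lambda>i. (\<epsilon> n ((i + 1) mod N) - \<epsilon> n i)\<^sup>2"] that
      by (simp add: cyclic_variation_def)
    then have "(\<lambda>n. (\<epsilon> n (Suc j) - \<epsilon> n j)\<^sup>2) \<longlonglongrightarrow> 0"
      by (intro tendsto_sandwich[OF _ _ tendsto_const D]) (auto intro: always_eventually)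
    then show ?thesis by simp
  qed
  have from_first: "(\<lambda>n. \<epsilon> n j - \<epsilon> n 0) \<longlonglongrightarrow> 0" if "j < N" for j
    using that
  proof (induction j)
    case (Suc j)
    then have "(\<lambda>n. (\<epsilon> n (Suc j) - \<epsilon> n j) + (\<epsilon> n j - \<epsilon> n 0)) \<longlonglongrightarrow> 0 + 0"
      by (intro tendsto_add neighbours Suc.IH) auto
    then show ?case by simp
  qed simp
  have "(\<lambda>n. \<Sum>j<N. \<epsilon> n j - \<epsilon> n 0) \<longlonglongrightarrow> (\<Sum>j<N. 0)"
    by (intro tendsto_sum from_first) simp
  moreover have "(\<Sum>j<N. \<epsilon> n j - \<epsilon> n 0) = - real N * \<epsilon> n 0" for n
    by (simp add: sum_subtractf mass)
  ultimately have "(\<lambda>n. - real N * \<epsilon> n 0) \<longlonglongrightarrow> 0" by simp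
  then have "(\<lambda>n. - real N * \<epsilon> n 0 / - real N) \<longlonglongrightarrow> 0 / - real N"
    using \<open>i < N\<close> by (intro tendsto_divide tendsto_const) auto
  then have "(\<lambda>n. \<epsilon> n 0) \<longlonglongrightarrow> 0" using \<open>i < N\<close> by simp
  from tendsto_add[OF from_first[OF \<open>i < N\<close>] this] show ?thesis by simp
qed

text \<open>
  On the Fourier mode with angle \<open>\<theta>\<close> the amplification factor satisfies
  \<open>\<bar>\<lambda>\<bar>\<^sup>2 = 1 - (1 - c) (2 p - p\<^sup>2 (1 - c) - q\<^sup>2 (1 + c))\<close> with \<open>c = cos \<theta>\<close>, \<open>p = \<beta> + \<xi>\<close>,
  \<open>q = \<beta> - \<xi>\<close>. The two hypotheses on the weights are positivity of the last factor at the
  extreme values \<open>c = -1\<close> and \<open>c = 1\<close>; it is affine in \<open>c\<close>.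
\<close>

lemma three_point_solution_tendsto_zero:
  fixes \<beta> \<xi> :: real and \<epsilon> :: "nat \<Rightarrow> nat \<Rightarrow> real"
  assumes p: "(\<beta> + \<xi>)\<^sup>2 < \<beta> + \<xi>" and q: "(\<beta> - \<xi>)\<^sup>2 < \<beta> + \<xi>"
    and sol: "linearised_solution N (1 - \<beta> - \<xi>) \<beta> 0 \<xi> \<epsilon>"
    and mass: "(\<Sum>i<N. \<epsilon> 0 i) = 0" and "i < N"
  shows "(\<lambda>n. \<epsilon> n i) \<longlonglongrightarrow> 0"
proof (rule tendsto_zero_if_cyclic_variation[OF _ _ \<open>i < N\<close>])
  have step: "\<epsilon> (Suc n) i =
      (1 - \<beta> - \<xi>) * \<epsilon> n i + \<beta> * \<epsilon> n ((i + 1) mod N) + \<xi> * \<epsilon> n ((i + N - 1) mod N)"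
    if "i < N" for n i
    using sol that by (simp add: linearised_solution_def)
  show "(\<Sum>i<N. \<epsilon> n i) = 0" for n
  proof (induction n)
    case 0
    show ?case by (fact mass)
  next
    case (Suc n)
    have "(\<Sum>i<N. \<epsilon> (Suc n) i) = (1 - \<beta> - \<xi>) * (\<Sum>i<N. \<epsilon> n i)
        + \<beta> * (\<Sum>i<N. \<epsilon> n ((i + 1) mod N)) + \<xi> * (\<Sum>i<N. \<epsilon> n ((i + N - 1) mod N))"
      by (simp add: step sum.distrib sum_distrib_left)
    then show ?case
      by (simp only: sum_cyclic_shift sum_cyclic_pred Suc.IH)
  qed
  define \<kappa> where "\<kappa> = min (\<beta> + \<xi> - (\<beta> + \<xi>)\<^sup>2) (\<beta> + \<xi> - (\<beta> - \<xi>)\<^sup>2)"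
  show "(\<lambda>n. cyclic_variation N (\<epsilon> n)) \<longlonglongrightarrow> 0"
  proof (rule dissipation_tendsto_zero)
    show "0 < \<kappa>" using p q by (simp add: \<kappa>_def)
    show "0 \<le> (\<Sum>i<N. (\<epsilon> n i)\<^sup>2)" for n by (simp add: sum_nonneg)
    show "0 \<le> cyclic_variation N (\<epsilon> n)" for n
      by (simp add: cyclic_variation_def sum_nonneg)
    show "(\<Sum>i<N. (\<epsilon> (Suc n) i)\<^sup>2) \<le>
        (\<Sum>i<N. (\<epsilon> n i)\<^sup>2) - \<kappa> * cyclic_variation N (\<epsilon> n)" for n
      unfolding \<kappa>_def by (rule three_point_energy_decay) (rule step)
  qed
qed

section \<open>Linearisation of the Godunov scheme\<close>

lemma deriv_opt_speed:
  assumes "\<rho> \<noteq> 0"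
  shows "deriv (opt_speed T l) \<rho> = - 1 / (T * \<rho>\<^sup>2)"
proof (rule DERIV_imp_deriv)
  have "((\<lambda>x. 1 / x - l) has_real_derivative - 1 / \<rho>\<^sup>2) (at \<rho>)"
    using assms by (auto intro!: derivative_eq_intros simp: power2_eq_square)
  from DERIV_cmult[OF this, of "1 / T"] show "(opt_speed T l has_real_derivative - 1 / (T * \<rho>\<^sup>2)) (at \<rho>)"
    by (simp add: opt_speed_def[abs_def])
qed

lemma cell_flux_nonzero:
  assumes "x \<noteq> 0"
  shows "cell_flux T l \<tau> dx x y = 1 / T * (1 - y * l) + \<tau> / dx * (1 / (T * x))\<^sup>2 * (y - x)"
  using assms
  by (simp add: cell_flux_def godunov_flux_def deriv_opt_speed power2_eq_square field_simps)

lemma cell_flux_deriv_upstream: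
  assumes "\<rho> \<noteq> 0"
  shows "((\<lambda>x. cell_flux T l \<tau> dx x \<rho>) has_real_derivative - (\<tau> / dx * (1 / (T * \<rho>))\<^sup>2))
           (at \<rho>)"
proof -
  define g where "g x = \<tau> / dx * (1 / (T * x))\<^sup>2" for x
  have "\<exists>g'. (g has_real_derivative g') (at \<rho>)"
  proof (cases "T = 0")
    case True
    then show ?thesis unfolding g_def by (auto intro: exI[of _ 0])
  next
    case False
    then show ?thesis
      unfolding g_def using assms by (intro exI) (rule derivative_eq_intros refl | simp)+
  qed
  then obtain g' where g': "(g has_real_derivative g') (at \<rho>)" ..
  \<comment> \<open>The term with \<open>g'\<close> drops out because its cofactor \<open>\<rho> - x\<close> vanishes at \<open>x = \<rho>\<close>.\<close>
  have "((\<lambda>x. 1 / T * (1 - \<rho> * l) + g x * (\<rho> - x)) has_real_derivative - g \<rho>) (at \<rho>)"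
    by (rule derivative_eq_intros g' refl | simp)+
  then have "((\<lambda>x. cell_flux T l \<tau> dx x \<rho>) has_real_derivative - g \<rho>) (at \<rho>)"
  proof (rule has_field_derivative_transform_within_open)
    show "open (- {0 :: real})" by (intro open_Compl closed_singleton)
  qed (use assms in \<open>auto simp: g_def cell_flux_nonzero\<close>)
  then show ?thesis by (simp add: g_def)
qed

lemma cell_flux_deriv_downstream:
  assumes "\<rho> \<noteq> 0"
  shows "((\<lambda>y. cell_flux T l \<tau> dx \<rho> y) has_real_derivative
           \<tau> / dx * (1 / (T * \<rho>))\<^sup>2 - l / T) (at \<rho>)"
  unfolding cell_flux_nonzero[OF assms]
  by (rule derivative_eq_intros refl | simp)+

lemma linearly_stable_godunov:
  fixes T l \<tau> dx dt \<rho> :: real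
  defines "k \<equiv> \<tau> / dx * (1 / (T * \<rho>))\<^sup>2"
  defines "\<beta> \<equiv> dt / dx * (l / T - k)" and "\<xi> \<equiv> - (dt / dx * k)"
  assumes "\<rho> \<noteq> 0" and p: "(\<beta> + \<xi>)\<^sup>2 < \<beta> + \<xi>" and q: "(\<beta> - \<xi>)\<^sup>2 < \<beta> + \<xi>"
  shows "linearly_stable N (scheme_update T l \<tau> dx dt) \<rho>"
proof -
  note up = cell_flux_deriv_upstream[OF \<open>\<rho> \<noteq> 0\<close>, of T l \<tau> dx, folded k_def]
  note down = cell_flux_deriv_downstream[OF \<open>\<rho> \<noteq> 0\<close>, of T l \<tau> dx, folded k_def]
  have "((\<lambda>x. scheme_update T l \<tau> dx dt x \<rho> \<rho> \<rho>) has_real_derivative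
      1 + dt / dx * ((k - l / T) - (- k))) (at \<rho>)"
    unfolding scheme_update_def by (intro DERIV_add DERIV_ident DERIV_cmult DERIV_diff up down)
  then have "((\<lambda>x. scheme_update T l \<tau> dx dt x \<rho> \<rho> \<rho>) has_real_derivative 1 - \<beta> - \<xi>) (at \<rho>)"
    by (simp add: \<beta>_def \<xi>_def algebra_simps)
  moreover have "((\<lambda>x. scheme_update T l \<tau> dx dt \<rho> x \<rho> \<rho>) has_real_derivative
      0 + dt / dx * (0 - (k - l / T))) (at \<rho>)"
    unfolding scheme_update_def by (intro DERIV_add DERIV_const DERIV_cmult DERIV_diff down)
  then have "((\<lambda>x. scheme_update T l \<tau> dx dt \<rho> x \<rho> \<rho>) has_real_derivative \<beta>) (at \<rho>)"
    by (simp add: \<beta>_def)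
  moreover have "((\<lambda>x. scheme_update T l \<tau> dx dt \<rho> \<rho> x \<rho>) has_real_derivative 0) (at \<rho>)"
    by (simp add: scheme_update_def)
  moreover have "((\<lambda>x. scheme_update T l \<tau> dx dt \<rho> \<rho> \<rho> x) has_real_derivative
      0 + dt / dx * (- k - 0)) (at \<rho>)"
    unfolding scheme_update_def by (intro DERIV_add DERIV_const DERIV_cmult DERIV_diff up)
  then have "((\<lambda>x. scheme_update T l \<tau> dx dt \<rho> \<rho> \<rho> x) has_real_derivative \<xi>) (at \<rho>)"
    by (simp add: \<xi>_def)
  ultimately show ?thesis
    unfolding linearly_stable_def using three_point_solution_tendsto_zero[OF p q] by blast
qed

theorem lemma3p3:
  fixes T l \<tau> dx \<rho>e :: real and N :: nat
  assumes "T > 0" and "l \<ge> 0" and "dx > 0" and "\<rho>e > 0" and "N \<ge> 2"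
    and "2 * \<tau> < T * l * dx * \<rho>e\<^sup>2"
  shows "\<exists>dt0>0. \<forall>dt. 0 < dt \<and> dt < dt0 \<longrightarrow>
           linearly_stable N (scheme_update T l \<tau> dx dt) \<rho>e"
proof -
  define k where "k = \<tau> / dx * (1 / (T * \<rho>e))\<^sup>2"
  define P where "P = l / T - 2 * k"
  define Q where "Q = l / T"
  have "P = (T * l * dx * \<rho>e\<^sup>2 - 2 * \<tau>) / (dx * T\<^sup>2 * \<rho>e\<^sup>2)"
    using assms by (simp add: P_def k_def power2_eq_square field_simps)
  then have "0 < P" using assms by simp
  then have PQ: "0 < P\<^sup>2 + Q\<^sup>2" by (simp add: add_pos_nonneg)
  \<comment> \<open>With \<open>s = dt / dx\<close> the weights satisfy \<open>\<beta> + \<xi> = s P\<close> and \<open>\<beta> - \<xi> = s Q\<close>, so stability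
    needs \<open>s P\<^sup>2 < P\<close> and \<open>s Q\<^sup>2 < P\<close>; both follow from \<open>s (P\<^sup>2 + Q\<^sup>2) < P\<close>.\<close>
  show ?thesis
  proof (intro exI[of _ "dx * P / (P\<^sup>2 + Q\<^sup>2)"] conjI allI impI)
    show "0 < dx * P / (P\<^sup>2 + Q\<^sup>2)" using \<open>0 < dx\<close> \<open>0 < P\<close> PQ by simp
    fix dt assume dt: "0 < dt \<and> dt < dx * P / (P\<^sup>2 + Q\<^sup>2)"
    define s where "s = dt / dx"
    have "0 < s" using dt \<open>0 < dx\<close> by (simp add: s_def)
    have "s * (P\<^sup>2 + Q\<^sup>2) < P"
      using dt PQ \<open>0 < dx\<close> by (simp add: s_def field_simps)
    then have "s * (s * (P\<^sup>2 + Q\<^sup>2)) < s * P" using \<open>0 < s\<close> by simp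
    then have sum: "(s * P)\<^sup>2 + (s * Q)\<^sup>2 < s * P"
      by (simp add: power2_eq_square algebra_simps)
    have plus: "s * (l / T - k) + - (s * k) = s * P"
      and minus: "s * (l / T - k) - - (s * k) = s * Q"
      by (simp_all add: P_def Q_def algebra_simps)
    have p: "(s * P)\<^sup>2 < s * P" and q: "(s * Q)\<^sup>2 < s * P"
      using sum zero_le_power2[of "s * P"] zero_le_power2[of "s * Q"] by linarith+
    show "linearly_stable N (scheme_update T l \<tau> dx dt) \<rho>e"
      using \<open>0 < \<rho>e\<close> p q linearly_stable_godunov[of \<rho>e dt dx l T \<tau> N]
      unfolding k_def[symmetric] s_def[symmetric] plus minus by simp
  qed
qed

end
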